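(* For any complex numbers $\alpha, x$ and any positive integer $n$, $$\sum_{k=0}^{n}\binom{n}{k}\binom{\alpha+k}{k}x^{k} = \sum_{k=0}^{n}\binom{\alpha}{n-k}\binom{\alpha+k}{k}(-1)^{n-k}(x+1)^{k}.$$
   Context: For a complex number $z$ and an integer $j\ge 0$, $\binom{z}{j}=\frac{z(z-1)\cdots(z-j+1)}{j!}$ (with $\binom{z}{0}=1$) is the generalized binomial coefficient. The convention $0^0=1$ is used for $x^0$ and $(x+1)^0$. *)

theory Defs
  imports Complex_Main
begin

end

theory Submission
  imports Defs "HOL-Computational_Algebra.Formal_Power_Series"
begin

text \<open>
  Both sides are polynomials in \<open>x\<close>, and they agree coefficient by coefficient. Expanding
  \<open>(x + 1) ^ k\<close> on the right, the coefficient of \<open>x ^ j\<close> contains the products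
  \<open>(\<alpha> + k gchoose k) * (k choose j)\<close>. Trinomial revision splits off the factor
  \<open>(\<alpha> + j gchoose j)\<close>, which is independent of \<open>k\<close>, and leaves the alternating convolution
  of \<open>gbinomial_alternating_Vandermonde\<close>. By the Chu--Vandermonde identity the dependence of
  that convolution on \<open>\<alpha>\<close> cancels, so that its value is the integer \<open>n choose j\<close>.
\<close>

text \<open>
  Negating the upper index turns \<open>(\<alpha> + j + m) gchoose m\<close> into
  \<open>(-1) ^ m * ((- \<alpha> - j - 1) gchoose m)\<close>. All signs then combine to \<open>(-1) ^ N\<close>, and the
  Chu--Vandermonde convolution has the upper index \<open>\<alpha> + (- \<alpha> - j - 1) = - (j + 1)\<close>.
\<close>

lemma gbinomial_alternating_Vandermonde:
  fixes \<alpha> :: "'a :: field_char_0"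
  shows "(\<Sum>m=0..N. (-1) ^ (N - m) * (\<alpha> gchoose (N - m)) * ((\<alpha> + of_nat (j + m)) gchoose m))
       = of_nat ((N + j) choose j)"
proof -
  have "(\<Sum>m=0..N. (-1) ^ (N - m) * (\<alpha> gchoose (N - m)) * ((\<alpha> + of_nat (j + m)) gchoose m))
      = (\<Sum>m=0..N. (-1) ^ N * (((- \<alpha> - of_nat j - 1) gchoose m) * (\<alpha> gchoose (N - m))))"
  proof (rule sum.cong)
    fix m assume "m \<in> {0..N}"
    then have sign: "(-1 :: 'a) ^ (N - m) * (-1) ^ m = (-1) ^ N"
      by (simp flip: power_add)
    have neg: "(\<alpha> + of_nat (j + m)) gchoose m = (-1) ^ m * ((- \<alpha> - of_nat j - 1) gchoose m)"
      by (subst gbinomial_negated_upper) (simp add: algebra_simps)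
    show "(-1) ^ (N - m) * (\<alpha> gchoose (N - m)) * ((\<alpha> + of_nat (j + m)) gchoose m)
        = (-1) ^ N * (((- \<alpha> - of_nat j - 1) gchoose m) * (\<alpha> gchoose (N - m)))"
      unfolding neg sign[symmetric] by (simp add: mult_ac)
  qed simp
  also have "\<dots> = (-1) ^ N * ((- of_nat (j + 1)) gchoose N)"
    using gbinomial_Vandermonde[of "- \<alpha> - of_nat j - 1" \<alpha> N]
    by (simp add: algebra_simps flip: sum_distrib_left)
  also have "\<dots> = of_nat (N + j) gchoose N"
    by (subst gbinomial_negated_upper) (simp add: algebra_simps flip: power_mult_distrib)
  also have "\<dots> = of_nat ((N + j) choose j)"
    by (metis add_diff_cancel_left' binomial_gbinomial binomial_symmetric le_add1)
  finally show ?thesis .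
qed

text \<open>
  Trinomial revision is applied to the complementary index \<open>k - j\<close>: subtracting it from the
  upper index \<open>\<alpha> + k\<close> gives \<open>\<alpha> + j\<close>, whereas subtracting \<open>j\<close> would leave no factor
  free of \<open>k\<close>.
\<close>

lemma gbinomial_diagonal_trinomial_revision:
  fixes \<alpha> :: "'a :: field_char_0"
  assumes "j \<le> k"
  shows "((\<alpha> + of_nat k) gchoose k) * of_nat (k choose j)
       = ((\<alpha> + of_nat j) gchoose j) * ((\<alpha> + of_nat k) gchoose (k - j))"
proof -
  have "(k choose j) = (k choose (k - j))"
    using assms by (rule binomial_symmetric)
  then show ?thesis
    using gbinomial_trinomial_revision[of "k - j" k "\<alpha> + of_nat k"] assms
    by (simp add: binomial_gbinomial of_nat_diff mult.commute)
qed

text \<open>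
  This evaluates the coefficient of \<open>x ^ j\<close> in the expansion in powers of \<open>x + 1\<close>; only the
  terms with \<open>k \<ge> j\<close> contribute to it. The substitution \<open>k = j + m\<close> turns the sum into the
  alternating convolution.
\<close>

lemma sum_gbinomial_diagonal_binomial:
  fixes \<alpha> :: "'a :: field_char_0"
  assumes "j \<le> n"
  shows "(\<Sum>k=j..n. (\<alpha> gchoose (n - k)) * ((\<alpha> + of_nat k) gchoose k)
                      * (-1) ^ (n - k) * of_nat (k choose j))
       = of_nat (n choose j) * ((\<alpha> + of_nat j) gchoose j)"
proof -
  obtain N where n: "n = N + j"
    using assms by (metis le_add_diff_inverse2)
  have "(\<Sum>k=j..n. (\<alpha> gchoose (n - k)) * ((\<alpha> + of_nat k) gchoose k)
                      * (-1) ^ (n - k) * of_nat (k choose j))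
      = (\<Sum>k=0+j..N+j. ((\<alpha> + of_nat j) gchoose j) * ((-1) ^ (n - k) * (\<alpha> gchoose (n - k))
                      * ((\<alpha> + of_nat k) gchoose (k - j))))"
  proof (rule sum.cong)
    fix k assume "k \<in> {0+j..N+j}"
    then show "(\<alpha> gchoose (n - k)) * ((\<alpha> + of_nat k) gchoose k) * (-1) ^ (n - k) * of_nat (k choose j)
        = ((\<alpha> + of_nat j) gchoose j) * ((-1) ^ (n - k) * (\<alpha> gchoose (n - k))
            * ((\<alpha> + of_nat k) gchoose (k - j)))"
      using gbinomial_diagonal_trinomial_revision[of j k \<alpha>] by (simp add: mult_ac)
  qed (simp add: n)
  also have "\<dots> = ((\<alpha> + of_nat j) gchoose j) * (\<Sum>m=0..N. (-1) ^ (N - m) * (\<alpha> gchoose (N - m))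
                      * ((\<alpha> + of_nat (j + m)) gchoose m))"
    by (subst sum.shift_bounds_cl_nat_ivl) (simp add: n sum_distrib_left add.commute)
  also have "\<dots> = of_nat (n choose j) * ((\<alpha> + of_nat j) gchoose j)"
    by (subst gbinomial_alternating_Vandermonde) (simp add: n mult.commute)
  finally show ?thesis .
qed

theorem proposition2:
  fixes \<alpha> x :: complex and n :: nat
  assumes "n > 0"
  shows "(\<Sum>k=0..n. of_nat (n choose k) * ((\<alpha> + of_nat k) gchoose k) * x ^ k)
       = (\<Sum>k=0..n. (\<alpha> gchoose (n - k)) * ((\<alpha> + of_nat k) gchoose k)
                      * (-1) ^ (n - k) * (x + 1) ^ k)"
proof -
  define c where "c k = (\<alpha> gchoose (n - k)) * ((\<alpha> + of_nat k) gchoose k) * (-1) ^ (n - k)" for k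
  have "(\<Sum>k=0..n. c k * (x + 1) ^ k) = (\<Sum>k=0..n. \<Sum>j=0..k. c k * of_nat (k choose j) * x ^ j)"
    by (simp add: binomial_ring sum_distrib_left mult_ac atMost_atLeast0)
  also have "\<dots> = (\<Sum>j=0..n. \<Sum>k=j..n. c k * of_nat (k choose j) * x ^ j)"
    unfolding sum.Sigma[OF finite_atLeastAtMost ballI, OF finite_atLeastAtMost]
    by (rule sum.reindex_bij_witness[of _ prod.swap prod.swap]) auto
  also have "\<dots> = (\<Sum>j=0..n. of_nat (n choose j) * ((\<alpha> + of_nat j) gchoose j) * x ^ j)"
    by (intro sum.cong refl)
       (simp add: c_def sum_gbinomial_diagonal_binomial flip: sum_distrib_right)
  finally show ?thesis
    by (simp add: c_def)
qed

end
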